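(* Let $p \geq 1$ be a real number and let $\theta \in [0,1]$. Let $X_1, X_2, \ldots$ be i.i.d. $\operatorname{Bernoulli}(\theta)$ random variables, and for $n \in \mathbb{N} = \{1,2,\ldots\}$ let $\bar X_n = n^{-1}(X_1 + \cdots + X_n)$ and $$b_n(p,\theta) := \mathsf{E}(\bar X_n^p) = \sum_{k=0}^n \binom{n}{k}\left(\frac{k}{n}\right)^p \theta^k (1-\theta)^{n-k}.$$ Then the sequence $\{b_n(p,\theta)\}_{n \geq 1}$ is log-convex; equivalently, $$b_n(p,\theta)^2 \leq b_{n-1}(p,\theta)\, b_{n+1}(p,\theta) \qquad \text{for every integer } n \geq 2.$$ Moreover, if $p > 1$ and $0 < \theta < 1$, then all of these inequalities are strict, i.e. $b_n(p,\theta)^2 < b_{n-1}(p,\theta)\, b_{n+1}(p,\theta)$ for every integer $n \geq 2$.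
   Context: $\operatorname{Bernoulli}(\theta)$ denotes the distribution on $\{0,1\}$ giving mass $\theta$ to $1$ and $1-\theta$ to $0$. $\mathsf{E}$ denotes expectation. In the sum, the convention $0^0 = 1$ is used for the factors $\theta^k$ and $(1-\theta)^{n-k}$ (relevant only when $\theta \in \{0,1\}$), and $0^p = 0$ since $p \geq 1$. *)

theory Defs
  imports "HOL-Probability.Probability"
begin

text \<open>The law of a real random variable that is 1 with probability \<open>\<theta>\<close> and 0 with
  probability \<open>1 - \<theta>\<close>. The library's \<^const>\<open>bernoulli_pmf\<close> lives on \<^typ>\<open>bool\<close> and clamps its
  parameter to the unit interval, so this is meaningful only for \<open>0 \<le> \<theta> \<le> 1\<close>.\<close>

definition bernoulli_law :: "real \<Rightarrow> real measure" where
  "bernoulli_law \<theta> = distr (measure_pmf (bernoulli_pmf \<theta>)) borel of_bool"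

text \<open>Sequences are indexed by the positive integers; the value at index 0 is never used.\<close>

definition sample_mean :: "(nat \<Rightarrow> 'a \<Rightarrow> real) \<Rightarrow> nat \<Rightarrow> 'a \<Rightarrow> real" where
  "sample_mean X n \<omega> = (\<Sum>i=1..n. X i \<omega>) / real n"

definition mean_moment :: "'a measure \<Rightarrow> (nat \<Rightarrow> 'a \<Rightarrow> real) \<Rightarrow> real \<Rightarrow> nat \<Rightarrow> real" where
  "mean_moment M X p n = integral\<^sup>L M (\<lambda>\<omega>. sample_mean X n \<omega> powr p)"

definition log_convex_seq :: "(nat \<Rightarrow> real) \<Rightarrow> bool" where
  "log_convex_seq a \<longleftrightarrow>
     (\<forall>n\<ge>1. 0 \<le> a n) \<and> (\<forall>n\<ge>2. (a n)\<^sup>2 \<le> a (n - 1) * a (n + 1))"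

end

theory Submission
  imports Defs
begin

text \<open>Put \<open>u = \<theta> / (1 - \<theta>)\<close>. Both \<open>b\<^sub>n\<^sup>2\<close> and \<open>b\<^bsub>n-1\<^esub> b\<^bsub>n+1\<^esub>\<close> are
  \<open>(1 - \<theta>)\<^bsup>2n\<^esup>\<close> times polynomials in \<open>u\<close>, and the inequality holds coefficient by coefficient:
  \<open>\<Sum> C(n,a) C(n,b) (ab / n\<^sup>2)\<^sup>p \<le> \<Sum> C(n-1,a) C(n+1,b) (ab / (n\<^sup>2-1))\<^sup>p\<close>, both sums over \<open>a + b = J\<close>.
  For \<open>p = 1\<close> this is an equality by Vandermonde. For \<open>p > 1\<close> summation by parts describes the
  difference of the two weight systems as a flow of mass between neighbouring values of \<open>ab\<close>;
  replacing powers by tangents along this flow leaves a sum \<open>\<Sum> G\<^sub>i x\<^sub>i\<^bsup>p-1\<^esup>\<close> with \<open>x\<^sub>i\<close> increasing, where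
  \<open>G\<close> has sum 0 and a single change of sign, from negative to positive, so that the sum is
  nonnegative. The coefficient at \<open>J = 2\<close> gives strictness.\<close>

subsection \<open>Summation by parts for products of binomial coefficients\<close>

text \<open>The reflection sending \<open>i\<close> to \<open>N - 1 - i\<close> pairs the lower half
  with the upper half; only the middle index of an odd \<open>N\<close> is its own partner and
  counts once.\<close>

lemma sum_fold_symmetric:
  fixes s :: "nat \<Rightarrow> real"
  assumes "\<And>i. i < N \<Longrightarrow> s (N - 1 - i) = s i"
  shows "(\<Sum>i<N. s i) = (\<Sum>i | 2 * i < N. (if Suc (2 * i) = N then 1 else 2) * s i)"
proof -
  let ?L = "{i. Suc (2 * i) < N}" and ?M = "{i. Suc (2 * i) = N}" and ?U = "{i. i < N \<and> N < Suc (2 * i)}"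
  have fin: "finite ?L" "finite ?M" "finite ?U"
    by (auto intro: finite_subset[of _ "{..<N}"])
  have U: "sum s ?U = sum s ?L"
    by (rule sum.reindex_bij_witness[of _ "\<lambda>i. N - 1 - i" "\<lambda>i. N - 1 - i"])
       (use assms in auto)
  have H: "{i. 2 * i < N} = ?L \<union> ?M"
    by auto
  have N: "{..<N} = (?L \<union> ?M) \<union> ?U"
    by auto
  have "(\<Sum>i<N. s i) = sum s (?L \<union> ?M) + sum s ?U"
    by (subst N, rule sum.union_disjoint) (use fin in auto)
  also have "sum s (?L \<union> ?M) = sum s ?L + sum s ?M"
    by (rule sum.union_disjoint) (use fin in auto)
  also have "sum s ?L + sum s ?M + sum s ?U = (\<Sum>i\<in>?L. 2 * s i) + sum s ?M"
    unfolding U by (simp add: sum_distrib_left[symmetric])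
  also have "\<dots> = (\<Sum>i\<in>?L. (if Suc (2 * i) = N then 1 else 2) * s i)
      + (\<Sum>i\<in>?M. (if Suc (2 * i) = N then 1 else 2) * s i)"
    by (intro arg_cong2[where f = "(+)"] sum.cong) auto
  also have "\<dots> = (\<Sum>i\<in>?L \<union> ?M. (if Suc (2 * i) = N then 1 else 2) * s i)"
    by (rule sum.union_disjoint[symmetric]) (use fin in auto)
  finally show ?thesis
    unfolding H .
qed

section \<open>Inequalities for sign changes and for powers\<close>

text \<open>Let \<open>s\<close> be the first index with \<open>G s > 0\<close>. On either side of
  \<open>s\<close> the factors \<open>G i\<close> and \<open>h i - h s\<close> do not have opposite
  signs, so the sum is at least \<open>h s\<close> times the sum of \<open>G\<close>.\<close>

lemma sum_mult_single_crossing_nonneg: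
  fixes G h :: "nat \<Rightarrow> real"
  assumes "finite A" and "0 \<le> (\<Sum>i\<in>A. G i)"
    and h: "\<And>i. i \<in> A \<Longrightarrow> 0 \<le> h i" "\<And>i k. i \<in> A \<Longrightarrow> k \<in> A \<Longrightarrow> i \<le> k \<Longrightarrow> h i \<le> h k"
    and G: "\<And>i k. i \<in> A \<Longrightarrow> k \<in> A \<Longrightarrow> i \<le> k \<Longrightarrow> 0 < G i \<Longrightarrow> 0 \<le> G k"
  shows "0 \<le> (\<Sum>i\<in>A. G i * h i)"
proof (cases "\<exists>i\<in>A. 0 < G i")
  case True
  define s where "s = (LEAST i. i \<in> A \<and> 0 < G i)"
  have s: "s \<in> A" "0 < G s"
    using LeastI_ex[of "\<lambda>i. i \<in> A \<and> 0 < G i"] True unfolding s_def by auto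
  have le: "G i * h s \<le> G i * h i" if "i \<in> A" for i
  proof (cases "s \<le> i")
    case True
    then show ?thesis
      using G[OF s(1) that True s(2)] h(2)[OF s(1) that True] by (intro mult_left_mono)
  next
    case False
    then have "G i \<le> 0"
      using not_less_Least[of i "\<lambda>i. i \<in> A \<and> 0 < G i"] that unfolding s_def by auto
    then show ?thesis
      using h(2)[OF that s(1)] False by (intro mult_left_mono_neg) auto
  qed
  have "0 \<le> (\<Sum>i\<in>A. G i) * h s"
    using assms(2) h(1)[OF s(1)] by simp
  also have "\<dots> \<le> (\<Sum>i\<in>A. G i * h i)"
    unfolding sum_distrib_right by (intro sum_mono le)
  finally show ?thesis .
next
  case False
  then have neg: "\<And>i. i \<in> A \<Longrightarrow> 0 \<le> - G i"
    by auto
  have "(\<Sum>i\<in>A. - G i) = 0"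
    using assms(2) sum_nonneg[of A "\<lambda>i. - G i"] neg by (simp add: sum_negf)
  then have "\<forall>i\<in>A. - G i = 0"
    using sum_nonneg_eq_0_iff[of A "\<lambda>i. - G i"] neg assms(1) by blast
  then show ?thesis
    by simp
qed

text \<open>Bernoulli's inequality: where the tangent is positive, it follows from concavity of
  \<open>ln\<close>; elsewhere the power is nonnegative anyway.\<close>

lemma powr_ge_tangent:
  fixes p t :: real
  assumes "1 \<le> p" "0 \<le> t"
  shows "1 + p * (t - 1) \<le> t powr p"
proof (cases "0 < 1 + p * (t - 1)")
  case True
  have "t \<noteq> 0"
    using True assms by auto
  have "0 < 1 / p" "1 / p \<le> 1"
    using assms by auto
  let ?s = "1 + p * (t - 1)"
  \<comment> \<open>\<open>t\<close> is the convex combination of \<open>1\<close> and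
    \<open>?s\<close> with weights \<open>1 - 1 / p\<close> and \<open>1 / p\<close>.\<close>
  have "(1 - 1 / p) * ln 1 + 1 / p * ln ?s \<le> ln ((1 - 1 / p) * 1 + 1 / p * ?s)"
    using concave_onD[OF ln_concave, of "1/p" 1 ?s] True assms by simp
  also have "(1 - 1 / p) * 1 + 1 / p * ?s = t"
    using assms by (simp add: field_simps)
  finally have "ln ?s \<le> p * ln t"
    using assms by (simp add: field_simps)
  then have "exp (ln ?s) \<le> exp (p * ln t)"
    by simp
  then show ?thesis
    using True \<open>t \<noteq> 0\<close> by (simp add: powr_def)
next
  case False
  then show ?thesis
    by (meson not_less order_trans powr_ge_zero)
qed

text \<open>The tangent of the \<open>p\<close>-th power at \<open>x\<close>, evaluated at
  \<open>c * y\<close>, bounds \<open>(c * y) powr p\<close> from below. The terms are grouped so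
  that the coefficient of \<open>x powr p\<close> is itself nonnegative, by the tangent bound at
  \<open>c\<close>.\<close>

lemma powr_diff_le:
  fixes p c x y :: real
  assumes "1 \<le> p" "0 \<le> c" "0 \<le> y" "0 < x"
  shows "c powr p * (x powr p - y powr p)
    \<le> (c powr p - 1 - p * (c - 1)) * x powr p + p * c * x powr (p - 1) * (x - y)"
proof -
  have "x powr p * (1 + p * (c * y / x - 1)) \<le> x powr p * (c * y / x) powr p"
    using powr_ge_tangent[of p "c * y / x"] assms by (intro mult_left_mono) auto
  also have "\<dots> = c powr p * y powr p"
    using assms by (simp add: powr_mult powr_divide)
  finally have "x powr p * (1 + p * (c * y / x - 1)) \<le> c powr p * y powr p" .
  moreover have "x powr p = x * x powr (p - 1)"
    using powr_mult_base[of x "p - 1"] assms by simp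
  then have "x powr p * (1 + p * (c * y / x - 1)) = x powr p - p * x powr p + p * c * y * x powr (p - 1)"
    and "x powr (p - 1) * x = x powr p"
    using assms by (simp_all add: field_simps)
  ultimately show ?thesis
    by (simp add: algebra_simps)
qed

section \<open>Pascal's rule, absorption and Vandermonde's identity\<close>

text \<open>Pascal's rule, applied to the first factor in one sum and to the second in the other,
  leaves a common part \<open>c\<close> and flows \<open>t i\<close> between \<open>z i\<close> and
  \<open>z (Suc i)\<close>. By symmetry of \<open>z\<close> opposite flows cancel, so only the net
  flow \<open>t i - t (K - i)\<close> matters.\<close>

lemma choose_sum_by_parts:
  fixes z :: "nat \<Rightarrow> real"
  assumes sym: "\<And>a. a \<le> Suc K \<Longrightarrow> z (Suc K - a) = z a"
  shows "real (Suc N) * ((\<Sum>a\<le>Suc K. real (Suc N choose a) * real (Suc N choose (Suc K - a)) * z a)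
      - (\<Sum>a\<le>Suc K. real (N choose a) * real (Suc (Suc N) choose (Suc K - a)) * z a))
    = (\<Sum>i | 2 * i < K. real (Suc N choose i) * real (Suc N choose (K - i)) * (real K - 2 * real i)
        * (z (Suc i) - z i))"
proof -
  let ?n = "Suc N"
  define w where "w i = z (Suc i) - z i" for i
  define t where "t i = real (N choose i) * real (?n choose (K - i))" for i
  define c where "c = (\<Sum>a\<le>Suc K. real (N choose a) * real (?n choose (Suc K - a)) * z a)"
  have Q: "(\<Sum>a\<le>Suc K. real (?n choose a) * real (?n choose (Suc K - a)) * z a) = c + (\<Sum>i\<le>K. t i * z (Suc i))"
  proof -
    have "(\<Sum>a\<le>Suc K. real (?n choose a) * real (?n choose (Suc K - a)) * z a) =
       real (?n choose Suc K) * z 0 + (\<Sum>i\<le>K. real (?n choose Suc i) * real (?n choose (K - i)) * z (Suc i))"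
      unfolding sum.atMost_Suc_shift by simp
    also have "\<dots> = c + (\<Sum>i\<le>K. t i * z (Suc i))"
      unfolding c_def sum.atMost_Suc_shift t_def by (simp add: algebra_simps sum.distrib)
    finally show ?thesis .
  qed
  have P: "(\<Sum>a\<le>Suc K. real (N choose a) * real (Suc ?n choose (Suc K - a)) * z a) = c + (\<Sum>i\<le>K. t i * z i)"
  proof -
    have "(\<Sum>a\<le>K. real (N choose a) * real (Suc ?n choose (Suc K - a)) * z a)
       = (\<Sum>a\<le>K. real (N choose a) * real (?n choose (Suc K - a)) * z a + t a * z a)"
      by (intro sum.cong) (auto simp: t_def Suc_diff_le algebra_simps)
    then show ?thesis
      unfolding c_def by (simp add: sum.distrib)
  qed
  have w_anti: "w (K - i) = - w i" if "i \<le> K" for i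
    using sym[of i] sym[of "Suc i"] that by (simp add: w_def Suc_diff_le)
  have t_diff: "real ?n * (t i - t (K - i)) = real (?n choose i) * real (?n choose (K - i)) * (real K - 2 * real i)"
    if "i \<le> K" for i
  proof -
    \<comment> \<open>Absorption brings both terms of \<open>t i - t (K - i)\<close> onto the same
      product of binomial coefficients.\<close>
    have *: "real ?n * real (N choose a) = (real ?n - real a) * real (?n choose a)" for a
    proof (cases "a \<le> ?n")
      case True
      then show ?thesis
        using binomial_absorb_comp[of ?n a] by (metis diff_Suc_1 of_nat_diff of_nat_mult)
    qed (simp add: binomial_eq_0)
    have "real ?n * (t i - t (K - i)) = real ?n * real (N choose i) * real (?n choose (K - i))
        - real ?n * real (N choose (K - i)) * real (?n choose i)"
      using that by (simp add: t_def algebra_simps)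
    also have "\<dots> = real (?n choose i) * real (?n choose (K - i)) * (real K - 2 * real i)"
      unfolding * using that by (simp add: of_nat_diff algebra_simps)
    finally show ?thesis .
  qed
  let ?s = "\<lambda>i. real (?n choose i) * real (?n choose (K - i)) * (real K - 2 * real i) * w i"
  have "(\<Sum>i\<le>K. t i * w i) = (\<Sum>i<Suc K. t (Suc K - Suc i) * w (Suc K - Suc i))"
    using sum.nat_diff_reindex[of "\<lambda>i. t i * w i" "Suc K"] by (simp only: lessThan_Suc_atMost)
  also have "\<dots> = (\<Sum>i\<le>K. - (t (K - i) * w i))"
    by (intro sum.cong) (auto simp: w_anti)
  finally have "2 * (\<Sum>i\<le>K. t i * w i) = (\<Sum>i\<le>K. t i * w i) + (\<Sum>i\<le>K. - (t (K - i) * w i))"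
    by simp
  also have "\<dots> = (\<Sum>i\<le>K. (t i - t (K - i)) * w i)"
    by (simp add: sum.distrib[symmetric] left_diff_distrib)
  finally have "2 * (real ?n * (\<Sum>i\<le>K. t i * w i)) = real ?n * (\<Sum>i\<le>K. (t i - t (K - i)) * w i)"
    by simp
  also have "\<dots> = (\<Sum>i<Suc K. ?s i)"
    unfolding sum_distrib_left
    by (intro sum.cong) (auto simp: t_diff mult.assoc[symmetric] simp del: of_nat_Suc)
  also have "\<dots> = (\<Sum>i | 2 * i < Suc K. (if Suc (2 * i) = Suc K then 1 else 2) * ?s i)"
    by (rule sum_fold_symmetric) (auto simp: w_anti of_nat_diff algebra_simps)
  \<comment> \<open>At \<open>2 * i = K\<close> the factor \<open>K - 2 * i\<close> vanishes, so the
    self-paired index drops out.\<close>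
  also have "\<dots> = (\<Sum>i | 2 * i < K. 2 * ?s i)"
    by (rule sum.mono_neutral_cong_right) (auto intro: finite_subset[of _ "{..K}"])
  finally have "real ?n * (\<Sum>i\<le>K. t i * w i) = (\<Sum>i | 2 * i < K. ?s i)"
    by (simp add: sum_distrib_left[symmetric])
  moreover have "(\<Sum>i\<le>K. t i * z (Suc i)) - (\<Sum>i\<le>K. t i * z i) = (\<Sum>i\<le>K. t i * w i)"
    by (simp add: sum_subtractf[symmetric] w_def right_diff_distrib)
  ultimately show ?thesis
    unfolding Q P w_def by simp
qed

text \<open>Absorbing \<open>a\<close> into one coefficient and its complement into the other leaves
  a Vandermonde convolution, whose value depends only on \<open>m + n\<close> and
  \<open>K\<close>.\<close>

lemma sum_choose_mult_index:
  "(\<Sum>a\<le>Suc (Suc K). real (Suc m choose a) * real (Suc n choose (Suc (Suc K) - a)) * (real a * real (Suc (Suc K) - a)))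
    = real (Suc m) * real (Suc n) * real ((m + n) choose K)"
proof -
  have absorb: "real (Suc i choose Suc k) * real (Suc k) = real (Suc i) * real (i choose k)" for i k
    using Suc_times_binomial[of k i] by (simp only: of_nat_mult[symmetric] mult.commute)
  have "(\<Sum>a\<le>Suc (Suc K). real (Suc m choose a) * real (Suc n choose (Suc (Suc K) - a)) * (real a * real (Suc (Suc K) - a)))
      = (\<Sum>a\<le>K. real (Suc m choose Suc a) * real (Suc n choose (Suc (K - a))) * (real (Suc a) * real (Suc (K - a))))"
    unfolding sum.atMost_Suc_shift[of _ "Suc K"]
    by (auto intro!: sum.cong simp: Suc_diff_le algebra_simps simp del: binomial_Suc_Suc)
  also have "\<dots> = (\<Sum>a\<le>K. (real (Suc m) * real (m choose a)) * (real (Suc n) * real (n choose (K - a))))"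
    unfolding absorb[symmetric] by (intro sum.cong) (simp_all only: mult_ac)
  also have "\<dots> = real (Suc m) * real (Suc n) * real (\<Sum>a\<le>K. (m choose a) * (n choose (K - a)))"
    unfolding of_nat_sum sum_distrib_left by (intro sum.cong) (simp_all only: mult_ac of_nat_mult)
  finally show ?thesis
    unfolding vandermonde .
qed

text \<open>The case \<open>p = 1\<close>, where the coefficients of \<open>b\<^sub>n\<^sup>2\<close> and of
  \<open>b\<^bsub>n-1\<^esub> b\<^bsub>n+1\<^esub>\<close> agree because both products equal \<open>\<theta>\<^sup>2\<close>.\<close>

lemma sum_choose_mult_index_balance:
  defines "x K a \<equiv> real a * real (Suc K - a)"
  shows "real (Suc N) * ((\<Sum>a\<le>Suc K. real (Suc N choose a) * real (Suc N choose (Suc K - a)) * x K a)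
      - (\<Sum>a\<le>Suc K. real (N choose a) * real (Suc (Suc N) choose (Suc K - a)) * x K a)) * real (Suc N)
    = (\<Sum>a\<le>Suc K. real (Suc N choose a) * real (Suc N choose (Suc K - a)) * x K a)"
proof (cases K)
  case 0
  then show ?thesis
    by (simp add: x_def)
next
  case (Suc K')
  show ?thesis
  proof (cases N)
    case 0
    have "(\<Sum>a\<le>Suc K. real (0 choose a) * real (Suc (Suc 0) choose (Suc K - a)) * x K a) = 0"
      by (rule sum.neutral) (auto simp: x_def binomial_eq_0_iff)
    then show ?thesis
      unfolding 0 by simp
  next
    case N: (Suc N')
    \<comment> \<open>Both sums carry the same binomial coefficient, and
      \<open>(N + 1)^2 - N * (N + 2) = 1\<close>, so their difference is that coefficient
      itself.\<close>
    show ?thesis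
      unfolding x_def Suc N sum_choose_mult_index by (simp add: algebra_simps)
  qed
qed

section \<open>Monotone products and the sign of the weights\<close>

lemma index_product_mono:
  fixes i k K :: nat
  assumes "i \<le> k" "2 * k < K"
  shows "real (Suc i) * real (K - i) \<le> real (Suc k) * real (K - k)"
proof -
  \<comment> \<open>This product is the right-hand side of the goal minus the left-hand
    side.\<close>
  have "0 \<le> (real k - real i) * (real K - real i - real k - 1)"
    using assms by (intro mult_nonneg_nonneg) linarith+
  then show ?thesis
    using assms by (simp add: of_nat_diff algebra_simps)
qed

text \<open>The quotient of \<open>(K - 2 * i)^2\<close> by \<open>(K - i) * (n - i)\<close> does
  not increase with \<open>i\<close>: its base \<open>K - 2 * i\<close> is at most either factor
  below, yet drops by 2 per step while they drop by 1.\<close>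

lemma bracket_single_crossing:
  fixes n K i k :: nat
  assumes "i \<le> k" "2 * k < K" "K - i \<le> n"
    and pos: "n * (real K - 2 * real i)\<^sup>2 \<le> 2 * real (K - i) * (real n - real i)"
  shows "n * (real K - 2 * real k)\<^sup>2 \<le> 2 * real (K - k) * (real n - real k)"
proof -
  define t where "t = real k - real i"
  define d where "d = real K - 2 * real k"
  define b where "b = real (K - k)"
  define c where "c = real n - real k"
  have t: "0 \<le> t" "0 < d" "d \<le> b" "d \<le> c" "0 < b" "0 < c"
    using assms(1-3) by (auto simp: t_def d_def b_def c_def of_nat_diff)
  have e: "real K - 2 * real i = d + 2 * t" "real (K - i) = b + t" "real n - real i = c + t"
    using assms(1,2) by (auto simp: t_def d_def b_def c_def of_nat_diff)
  have "d * (b + t) \<le> (d + 2 * t) * b" "d * (c + t) \<le> (d + 2 * t) * c"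
    using mult_right_mono[of d "2 * b" t] mult_right_mono[of d "2 * c" t] t by (simp_all add: algebra_simps)
  then have "(d * (b + t)) * (d * (c + t)) \<le> ((d + 2 * t) * b) * ((d + 2 * t) * c)"
    by (rule mult_mono) (use t in \<open>simp_all add: mult_nonneg_nonneg less_imp_le\<close>)
  then have 1: "d\<^sup>2 * ((b + t) * (c + t)) \<le> (d + 2 * t)\<^sup>2 * (b * c)"
    by (simp add: power2_eq_square algebra_simps)
  have "n * d\<^sup>2 * ((b + t) * (c + t)) \<le> n * (d + 2 * t)\<^sup>2 * (b * c)"
    using mult_left_mono[OF 1, of "real n"] by (simp add: mult_ac)
  also have "\<dots> \<le> 2 * (b + t) * (c + t) * (b * c)"
    using pos t unfolding e by (intro mult_right_mono) auto
  finally have "(n * d\<^sup>2) * ((b + t) * (c + t)) \<le> (2 * b * c) * ((b + t) * (c + t))"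
    by (simp only: mult_ac)
  then have "n * d\<^sup>2 \<le> 2 * b * c"
    using t by (simp add: mult_le_cancel_right add_nonneg_pos add_pos_nonneg)
  then show ?thesis
    by (simp add: d_def b_def c_def)
qed

text \<open>The products \<open>a (K + 1 - a)\<close> increase towards the middle index, so the second row of
  weights arises from the first by moving mass to smaller products; the factor \<open>c\<close> compensates.
  Bounding each move by the tangent of the convex power reduces the claim to the estimates
  \<open>linear\<close> and \<open>quadratic\<close>.\<close>

lemma choose_product_sum_powr_le:
  fixes p :: real and K N :: nat
  assumes p: "1 \<le> p" and N: "1 \<le> N"
  defines "x a \<equiv> real a * real (Suc K - a)"
  defines "c \<equiv> (real (Suc N))\<^sup>2 / (real N * real (Suc (Suc N)))"
  shows "(\<Sum>a\<le>Suc K. real (Suc N choose a) * real (Suc N choose (Suc K - a)) * x a powr p)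
    \<le> c powr p * (\<Sum>a\<le>Suc K. real (N choose a) * real (Suc (Suc N) choose (Suc K - a)) * x a powr p)"
    (is "?A \<le> _ * ?P")
proof -
  define n where "n = Suc N"
  define H where "H = {i. 2 * i < K}"
  \<comment> \<open>\<open>e i * d i\<close> will be the net flow across the step from
    \<open>i\<close> to \<open>Suc i\<close>, \<open>d i\<close> the increment of \<open>x\<close>
    there, and \<open>m i\<close> the multiplicity after folding onto \<open>H\<close>.\<close>
  define e where "e i = real (n choose i) * real (n choose (K - i))" for i
  define Q where "Q a = real (n choose a) * real (n choose (Suc K - a))" for a
  define d where "d i = real K - 2 * real i" for i :: nat
  define m where "m i = (if Suc (2 * i) = K then 1 else 2 :: real)" for i :: nat
  have finH: "finite H"
    by (auto simp: H_def intro: finite_subset[of _ "{..K}"])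
  have x_sym: "x (Suc K - a) = x a" and Q_sym: "Q (Suc K - a) = Q a" if "a \<le> Suc K" for a
    using that by (simp_all add: x_def Q_def)
  have x_nn: "0 \<le> x a" for a
    by (simp add: x_def)
  have x_Suc: "x (Suc i) = real (Suc i) * real (K - i)" for i
    by (simp add: x_def)
  have x_pos: "0 < x (Suc i)" if "i \<in> H" for i
    using that by (simp add: x_def H_def)
  have x_diff: "x (Suc i) - x i = d i" if "i \<in> H" for i
    using that by (simp add: x_def d_def H_def of_nat_diff algebra_simps)
  have d_pos: "0 < d i" if "i \<in> H" for i
    using that by (simp add: d_def H_def)
  have Q_nn: "0 \<le> Q a" and e_nn: "0 \<le> e i" for a i
    by (simp_all add: Q_def e_def)
  have eQ: "e i * (real n - real i) = Q (Suc i) * real (Suc i)" for i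
  proof -
    have "real (Suc i) * real (n choose Suc i) = (real n - real i) * real (n choose i)"
    proof (cases "i \<le> n")
      case True
      then show ?thesis
        unfolding of_nat_mult[symmetric] of_nat_diff[OF True, symmetric]
        by (metis binomial_absorb_comp binomial_absorption)
    qed (simp add: binomial_eq_0)
    then show ?thesis
      unfolding e_def Q_def diff_Suc_Suc by algebra
  qed
  \<comment> \<open>Both weights contain \<open>n choose (K - i)\<close>, and
    \<open>Suc i \<le> K - i\<close> on \<open>H\<close>; hence \<open>n - i\<close> is positive
    wherever a weight is nonzero and can be cancelled.\<close>
  have in_range: "K - i \<le> n \<and> Suc i \<le> n" if "i \<in> H" "e i \<noteq> 0 \<or> Q (Suc i) \<noteq> 0" for i
  proof -
    have "\<not> n < K - i"
      using that by (auto simp: e_def Q_def binomial_eq_0)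
    then show ?thesis
      using that(1) by (auto simp: H_def)
  qed
  have A: "?A = (\<Sum>a\<le>Suc K. Q a * x a powr p)"
    by (simp add: Q_def n_def)
  \<comment> \<open>The end terms vanish because \<open>x 0 = x (Suc K) = 0\<close>; the others,
    \<open>a = Suc i\<close> with \<open>i < K\<close>, fold onto \<open>H\<close>.\<close>
  have fold_Q: "(\<Sum>a\<le>Suc K. Q a * (x a * f (x a))) = (\<Sum>i\<in>H. m i * (Q (Suc i) * x (Suc i)) * f (x (Suc i)))"
    for f :: "real \<Rightarrow> real"
  proof -
    have "(\<Sum>a\<le>Suc K. Q a * (x a * f (x a))) = (\<Sum>i\<le>K. Q (Suc i) * (x (Suc i) * f (x (Suc i))))"
      unfolding sum.atMost_Suc_shift by (simp add: x_def)
    also have "\<dots> = (\<Sum>i<K. Q (Suc i) * (x (Suc i) * f (x (Suc i))))"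
      by (simp add: lessThan_Suc_atMost[symmetric] x_def)
    also have "\<dots> = (\<Sum>i\<in>H. m i * (Q (Suc i) * (x (Suc i) * f (x (Suc i)))))"
      unfolding H_def m_def
    proof (rule sum_fold_symmetric)
      fix i assume "i < K"
      then have "Suc (K - 1 - i) = Suc K - Suc i" "Suc i \<le> Suc K"
        by auto
      then show "Q (Suc (K - 1 - i)) * (x (Suc (K - 1 - i)) * f (x (Suc (K - 1 - i)))) = Q (Suc i) * (x (Suc i) * f (x (Suc i)))"
        by (simp only: x_sym Q_sym)
    qed
    finally show ?thesis
      by (simp only: mult.assoc)
  qed
  have parts: "real n * ((\<Sum>a\<le>Suc K. Q a * z a)
      - (\<Sum>a\<le>Suc K. real (N choose a) * real (Suc (Suc N) choose (Suc K - a)) * z a))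
    = (\<Sum>i\<in>H. e i * d i * (z (Suc i) - z i))" if "\<And>a. a \<le> Suc K \<Longrightarrow> z (Suc K - a) = z a" for z
    using choose_sum_by_parts[of K z N, OF that] unfolding H_def e_def d_def Q_def n_def .
  \<comment> \<open>\<open>?G\<close> sums to 0 by the case \<open>p = 1\<close> and changes sign once, from negative to positive.\<close>
  let ?G = "\<lambda>i. m i * (Q (Suc i) * x (Suc i)) - real n * (e i * (d i)\<^sup>2)"
  have G0: "(\<Sum>i\<in>H. ?G i) = 0"
  proof -
    have "real n * (\<Sum>i\<in>H. e i * d i * (x (Suc i) - x i)) = (\<Sum>a\<le>Suc K. Q a * (x a * 1))"
      using parts[of x, OF x_sym] sum_choose_mult_index_balance[of N K]
      by (simp add: x_def Q_def n_def mult_ac)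
    also have "\<dots> = (\<Sum>i\<in>H. m i * (Q (Suc i) * x (Suc i)) * 1)"
      by (rule fold_Q)
    finally show ?thesis
      by (simp add: sum_subtractf sum_distrib_left x_diff power2_eq_square mult.assoc)
  qed
  have G_alt: "?G i * (real n - real i) = Q (Suc i) * real (Suc i) *
      (m i * real (K - i) * (real n - real i) - real n * (d i)\<^sup>2)" for i
  proof -
    have "?G i * (real n - real i) = m i * (Q (Suc i) * x (Suc i)) * (real n - real i)
        - real n * (e i * (real n - real i)) * (d i)\<^sup>2"
      by (simp add: algebra_simps)
    then show ?thesis
      unfolding eQ x_Suc by (simp add: algebra_simps)
  qed
  have cross: "0 \<le> ?G k" if "i \<in> H" "k \<in> H" "i \<le> k" "0 < ?G i" for i k
  proof (cases "e k = 0 \<and> Q (Suc k) = 0")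
    case True
    then show ?thesis by simp
  next
    case False
    then have k: "K - k \<le> n" "Suc k \<le> n"
      using in_range[OF that(2)] by auto
    have "e i \<noteq> 0 \<or> Q (Suc i) \<noteq> 0"
      using that(4) by auto
    then have i: "K - i \<le> n" "Suc i \<le> n"
      using in_range[OF that(1)] by auto
    have "0 \<le> m k * real (K - k) * (real n - real k) - real n * (d k)\<^sup>2"
    proof (cases "Suc (2 * k) = K")
      case True
      \<comment> \<open>With \<open>K = 2 * k + 1\<close>, both \<open>m k\<close> and
        \<open>d k\<close> are 1 and the bracket equals this product.\<close>
      have "0 \<le> (real n - real k - 1) * real k"
        using k by (intro mult_nonneg_nonneg) auto
      then show ?thesis
        using True by (auto simp: m_def d_def algebra_simps)
    next
      case False
      have "0 < ?G i * (real n - real i)"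
        using that(4) i by (intro mult_pos_pos) auto
      then have "0 < m i * real (K - i) * (real n - real i) - real n * (d i)\<^sup>2"
        unfolding G_alt using Q_nn[of "Suc i"]
        by (meson mult_nonneg_nonneg not_less of_nat_0_le_iff zero_less_mult_iff)
      moreover have "m i \<le> 2"
        by (simp add: m_def)
      then have "m i * (real (K - i) * (real n - real i)) \<le> 2 * (real (K - i) * (real n - real i))"
        using i by (intro mult_right_mono) auto
      ultimately have "real n * (d i)\<^sup>2 \<le> 2 * real (K - i) * (real n - real i)"
        by (simp add: mult.assoc)
      then show ?thesis
        using bracket_single_crossing[of i k K n] that(2,3) i False by (simp add: m_def d_def H_def)
    qed
    then have "0 \<le> ?G k * (real n - real k)"
      unfolding G_alt using Q_nn by (intro mult_nonneg_nonneg) auto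
    then show ?thesis
      using k by (simp add: zero_le_mult_iff)
  qed
  have x_powr: "x a powr p = x a * x a powr (p - 1)" for a
    using powr_mult_base[of "x a" "p - 1"] x_nn by simp
  \<comment> \<open>Weighting the zero sum of \<open>?G\<close> by the increasing
    \<open>x (Suc i) powr (p - 1)\<close> makes it nonnegative; its \<open>Q\<close> part unfolds
    back to \<open>?A\<close>.\<close>
  have quadratic: "real n * (\<Sum>i\<in>H. e i * (d i)\<^sup>2 * x (Suc i) powr (p - 1)) \<le> ?A"
  proof -
    have "0 \<le> (\<Sum>i\<in>H. ?G i * x (Suc i) powr (p - 1))"
    proof (rule sum_mult_single_crossing_nonneg[OF finH])
      show "x (Suc i) powr (p - 1) \<le> x (Suc k) powr (p - 1)" if "i \<in> H" "k \<in> H" "i \<le> k" for i k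
        using index_product_mono[of i k K] that p x_nn unfolding x_Suc
        by (intro powr_mono2) (auto simp: H_def)
    qed (use G0 cross in auto)
    then show ?thesis
      unfolding A unfolding x_powr fold_Q[of "\<lambda>y. y powr (p - 1)"] by (simp add: left_diff_distrib sum_subtractf sum_distrib_left mult.assoc)
  qed
  have linear: "(\<Sum>i\<in>H. e i * d i * x (Suc i) powr p) \<le> real n * ?A"
  proof -
    \<comment> \<open>After multiplication by \<open>n - i\<close> and use of \<open>eQ\<close>,
      this is \<open>d i \<le> n - i\<close> times \<open>Suc i \<le> n\<close>.\<close>
    have "e i * d i \<le> real n * Q (Suc i)" if "i \<in> H" for i
    proof (cases "e i = 0")
      case False
      then have i: "K - i \<le> n" "Suc i \<le> n"
        using in_range[OF that] by auto
      have "d i * real (Suc i) \<le> (real n - real i) * real n"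
        using i that by (intro mult_mono) (auto simp: d_def H_def)
      then have "Q (Suc i) * (d i * real (Suc i)) \<le> Q (Suc i) * ((real n - real i) * real n)"
        using Q_nn by (rule mult_left_mono)
      then have "(e i * d i) * (real n - real i) \<le> (real n * Q (Suc i)) * (real n - real i)"
        using eQ[of i] by (simp add: mult_ac)
      then show ?thesis
        using i by simp
    qed (use Q_nn in simp)
    then have "(\<Sum>i\<in>H. e i * d i * x (Suc i) powr p) \<le> (\<Sum>i\<in>H. real n * Q (Suc i) * x (Suc i) powr p)"
      by (intro sum_mono mult_right_mono) auto
    also have "\<dots> = real n * (\<Sum>a\<in>Suc ` H. Q a * x a powr p)"
      by (simp add: sum.reindex sum_distrib_left mult_ac)
    also have "\<dots> \<le> real n * ?A"
      unfolding A using Q_nn by (intro mult_left_mono sum_mono2) (auto simp: H_def)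
    finally show ?thesis .
  qed
  define \<kappa> where "\<kappa> = c powr p - 1 - p * (c - 1)"
  have c_pos: "0 \<le> c"
    by (simp add: c_def)
  have c_minus: "c - 1 = 1 / (real N * real (Suc (Suc N)))"
  proof -
    have "real N * real (Suc (Suc N)) \<noteq> 0"
      using N by simp
    moreover have "(real (Suc N))\<^sup>2 = real N * real (Suc (Suc N)) + 1"
      by (simp add: power2_eq_square algebra_simps)
    ultimately show ?thesis
      unfolding c_def by (simp only: add_divide_distrib) simp
  qed
  have c_n: "c = real n * real n * (c - 1)"
    unfolding c_minus by (simp add: c_def n_def power2_eq_square)
  have \<kappa>: "0 \<le> \<kappa>"
    using powr_ge_tangent[OF p c_pos] by (simp add: \<kappa>_def)
  have "real n * (c powr p * (?A - ?P)) = c powr p * (\<Sum>i\<in>H. e i * d i * (x (Suc i) powr p - x i powr p))"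
    using parts[of "\<lambda>a. x a powr p"] x_sym unfolding A by simp
  also have "\<dots> = (\<Sum>i\<in>H. e i * d i * (c powr p * (x (Suc i) powr p - x i powr p)))"
    by (simp add: sum_distrib_left mult_ac)
  also have "\<dots> \<le> (\<Sum>i\<in>H. e i * d i * (\<kappa> * x (Suc i) powr p + p * c * x (Suc i) powr (p - 1) * d i))"
  proof (intro sum_mono mult_left_mono)
    fix i assume i: "i \<in> H"
    show "c powr p * (x (Suc i) powr p - x i powr p) \<le> \<kappa> * x (Suc i) powr p + p * c * x (Suc i) powr (p - 1) * d i"
      using powr_diff_le[OF p c_pos x_nn x_pos[OF i], of i] unfolding \<kappa>_def x_diff[OF i] .
    show "0 \<le> e i * d i"
      using e_nn d_pos[OF i] by (simp add: less_imp_le)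
  qed
  also have "\<dots> = \<kappa> * (\<Sum>i\<in>H. e i * d i * x (Suc i) powr p)
      + p * c * (\<Sum>i\<in>H. e i * (d i)\<^sup>2 * x (Suc i) powr (p - 1))"
    by (simp add: sum_distrib_left sum.distrib power2_eq_square distrib_left mult_ac)
  \<comment> \<open>Since \<open>c = n^2 * (c - 1)\<close>, the sum acquires the factor
    \<open>n\<close> with which \<open>quadratic\<close> bounds it by \<open>?A\<close>.\<close>
  also have "p * c * (\<Sum>i\<in>H. e i * (d i)\<^sup>2 * x (Suc i) powr (p - 1))
     = p * (c - 1) * real n * (real n * (\<Sum>i\<in>H. e i * (d i)\<^sup>2 * x (Suc i) powr (p - 1)))"
    by (subst c_n) (simp only: mult_ac)
  also have "\<kappa> * (\<Sum>i\<in>H. e i * d i * x (Suc i) powr p) + \<dots>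
      \<le> \<kappa> * (real n * ?A) + p * (c - 1) * real n * ?A"
  proof (intro add_mono mult_left_mono linear quadratic \<kappa>)
    have "0 \<le> c - 1"
      by (simp add: c_minus)
    then show "0 \<le> p * (c - 1) * real n"
      using p by simp
  qed
  \<comment> \<open>The \<open>p * (c - 1)\<close> in \<open>\<kappa>\<close> cancels; what remains
    is the claim rearranged.\<close>
  also have "\<dots> = real n * ((c powr p - 1) * ?A)"
    by (simp add: \<kappa>_def algebra_simps)
  finally have "c powr p * (?A - ?P) \<le> (c powr p - 1) * ?A"
    by (simp add: n_def)
  then show ?thesis
    by (simp add: algebra_simps)
qed

subsection \<open>Binomial moments\<close>

text \<open>The factor \<open>c powr p\<close> of \<open>choose_product_sum_powr_le\<close> is the
  quotient of the \<open>p\<close>-th powers of the denominators \<open>(N + 1)^2\<close> and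
  \<open>N * (N + 2)\<close>.\<close>

lemma binomial_mean_coeff_le:
  fixes p :: real
  assumes p: "1 \<le> p" and N: "1 \<le> N"
  defines "f m k \<equiv> real (m choose k) * (real k / real m) powr p"
  shows "(\<Sum>a\<le>J. f (Suc N) a * f (Suc N) (J - a)) \<le> (\<Sum>a\<le>J. f N a * f (Suc (Suc N)) (J - a))"
proof (cases J)
  case 0
  then show ?thesis
    by (simp add: f_def)
next
  case (Suc K)
  define x where "x a = real a * real (Suc K - a)" for a
  have f: "f l a * f m (Suc K - a) = real (l choose a) * real (m choose (Suc K - a)) * x a powr p / (real l * real m) powr p"
    for l m a
    unfolding f_def x_def powr_mult powr_divide by simp
  define A where "A = (\<Sum>a\<le>Suc K. real (Suc N choose a) * real (Suc N choose (Suc K - a)) * x a powr p)"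
  define P where "P = (\<Sum>a\<le>Suc K. real (N choose a) * real (Suc (Suc N) choose (Suc K - a)) * x a powr p)"
  have "A \<le> ((real (Suc N))\<^sup>2 / (real N * real (Suc (Suc N)))) powr p * P"
    using choose_product_sum_powr_le[OF p N] unfolding A_def P_def x_def .
  then have "A \<le> (real (Suc N) * real (Suc N)) powr p * P / (real N * real (Suc (Suc N))) powr p"
    by (simp add: powr_divide power2_eq_square)
  then have "A / (real (Suc N) * real (Suc N)) powr p \<le> P / (real N * real (Suc (Suc N))) powr p"
    by (simp add: divide_le_eq mult_ac)
  then show ?thesis
    unfolding Suc f A_def P_def sum_divide_distrib .
qed

text \<open>Only \<open>a = 1\<close> survives, since \<open>0 powr p = 0\<close>, and gives
  \<open>(l * m) powr (1 - p)\<close>; the exponent is negative and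
  \<open>N * (N + 2) < (N + 1)^2\<close>.\<close>

lemma binomial_mean_coeff_2_less:
  fixes p :: real
  assumes p: "1 < p" and N: "1 \<le> N"
  defines "f m k \<equiv> real (m choose k) * (real k / real m) powr p"
  shows "(\<Sum>a\<le>2. f (Suc N) a * f (Suc N) (2 - a)) < (\<Sum>a\<le>2. f N a * f (Suc (Suc N)) (2 - a))"
proof -
  have two: "{..2::nat} = {0, 1, 2}"
    by auto
  have 1: "(\<Sum>a\<le>2. f l a * f m (2 - a)) = (real l * real m) powr (1 - p)"
    if "1 \<le> l" "1 \<le> m" for l m
    using that by (simp add: two f_def powr_diff powr_divide powr_mult)
  have "(real (Suc N) * real (Suc N)) powr (1 - p) < (real N * real (Suc (Suc N))) powr (1 - p)"
  proof (rule powr_less_mono2_neg)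
    show "0 < real N * real (Suc (Suc N))"
      using N by simp
  qed (use p in \<open>simp_all add: algebra_simps\<close>)
  then show ?thesis
    using N by (simp add: 1)
qed

section \<open>The moments as polynomials in the odds\<close>

definition binomial_mean_moment :: "real \<Rightarrow> real \<Rightarrow> nat \<Rightarrow> real" where
  "binomial_mean_moment p \<theta> n =
    (\<Sum>k=0..n. real (n choose k) * (real k / real n) powr p * \<theta> ^ k * (1 - \<theta>) ^ (n - k))"

lemma binomial_mean_moment_nonneg:
  "0 \<le> \<theta> \<Longrightarrow> \<theta> \<le> 1 \<Longrightarrow> 0 \<le> binomial_mean_moment p \<theta> n"
  unfolding binomial_mean_moment_def by (intro sum_nonneg mult_nonneg_nonneg) auto

lemma binomial_mean_moment_1:
  assumes "1 \<le> n"
  shows "binomial_mean_moment p 1 n = 1"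
proof -
  have "binomial_mean_moment p 1 n = (\<Sum>k\<in>{n}. real (n choose k) * (real k / real n) powr p)"
    unfolding binomial_mean_moment_def by (rule sum.mono_neutral_cong_right) auto
  then show ?thesis
    using assms by simp
qed

lemma binomial_mean_moment_mult:
  assumes "\<theta> < 1"
  shows "binomial_mean_moment p \<theta> l * binomial_mean_moment p \<theta> m = (1 - \<theta>) ^ (l + m) *
    (\<Sum>r\<le>l + m. (\<Sum>a\<le>r. (real (l choose a) * (real a / real l) powr p)
      * (real (m choose (r - a)) * (real (r - a) / real m) powr p)) * (\<theta> / (1 - \<theta>)) ^ r)"
proof -
  define u where "u = \<theta> / (1 - \<theta>)"
  define f where "f m k = real (m choose k) * (real k / real m) powr p" for m k :: nat
  have eq: "binomial_mean_moment p \<theta> m = (1 - \<theta>) ^ m * (\<Sum>k\<le>m. f m k * u ^ k)" for m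
    unfolding binomial_mean_moment_def sum_distrib_left atLeast0AtMost
  proof (rule sum.cong)
    fix k assume "k \<in> {..m}"
    then have "(1 - \<theta>) ^ m = (1 - \<theta>) ^ k * (1 - \<theta>) ^ (m - k)"
      by (simp add: power_add[symmetric])
    then show "real (m choose k) * (real k / real m) powr p * \<theta> ^ k * (1 - \<theta>) ^ (m - k)
      = (1 - \<theta>) ^ m * (f m k * u ^ k)"
      using assms by (simp add: f_def u_def power_divide)
  qed simp
  have "(\<Sum>k\<le>l. f l k * u ^ k) * (\<Sum>k\<le>m. f m k * u ^ k)
      = (\<Sum>r\<le>l + m. (\<Sum>a\<le>r. f l a * f m (r - a)) * u ^ r)"
    \<comment> \<open>Coefficients beyond the degree vanish, so the inner sums may run over all
      \<open>a \<le> r\<close>.\<close>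
    by (rule polynomial_product) (auto simp: f_def binomial_eq_0)
  then show ?thesis
    unfolding eq f_def u_def by (simp add: power_add mult_ac)
qed

lemma binomial_mean_moment_log_convex:
  assumes p: "1 \<le> p" and \<theta>: "0 \<le> \<theta>" "\<theta> \<le> 1" and N: "1 \<le> N"
  shows "(binomial_mean_moment p \<theta> (Suc N))\<^sup>2
    \<le> binomial_mean_moment p \<theta> N * binomial_mean_moment p \<theta> (Suc (Suc N))"
proof (cases "\<theta> = 1")
  case True
  then show ?thesis
    using N by (simp add: binomial_mean_moment_1)
next
  case False
  then have 1: "\<theta> < 1"
    using \<theta> by simp
  \<comment> \<open>Equal total degrees give both products the same prefactor and the same range of
    \<open>r\<close>.\<close>
  have eq: "Suc N + Suc N = N + Suc (Suc N)"
    by simp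
  show ?thesis
    unfolding power2_eq_square binomial_mean_moment_mult[OF 1] eq
    by (intro mult_left_mono sum_mono mult_right_mono binomial_mean_coeff_le[OF p N]) (use 1 \<theta> in auto)
qed

lemma binomial_mean_moment_strict_log_convex:
  assumes p: "1 < p" and \<theta>: "0 < \<theta>" "\<theta> < 1" and N: "1 \<le> N"
  shows "(binomial_mean_moment p \<theta> (Suc N))\<^sup>2
    < binomial_mean_moment p \<theta> N * binomial_mean_moment p \<theta> (Suc (Suc N))"
proof -
  let ?f = "\<lambda>m k. real (m choose k) * (real k / real m) powr p"
  let ?u = "\<theta> / (1 - \<theta>)"
  have "Suc N + Suc N = N + Suc (Suc N)"
    by simp
  moreover have "(\<Sum>r\<le>N + Suc (Suc N). (\<Sum>a\<le>r. ?f (Suc N) a * ?f (Suc N) (r - a)) * ?u ^ r)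
    < (\<Sum>r\<le>N + Suc (Suc N). (\<Sum>a\<le>r. ?f N a * ?f (Suc (Suc N)) (r - a)) * ?u ^ r)"
  proof (rule sum_strict_mono_ex1)
    show "\<forall>r\<in>{..N + Suc (Suc N)}. (\<Sum>a\<le>r. ?f (Suc N) a * ?f (Suc N) (r - a)) * ?u ^ r
      \<le> (\<Sum>a\<le>r. ?f N a * ?f (Suc (Suc N)) (r - a)) * ?u ^ r"
      using binomial_mean_coeff_le[of p N] p N \<theta> by (intro ballI mult_right_mono) auto
    have "(\<Sum>a\<le>2. ?f (Suc N) a * ?f (Suc N) (2 - a)) * ?u\<^sup>2
      < (\<Sum>a\<le>2. ?f N a * ?f (Suc (Suc N)) (2 - a)) * ?u\<^sup>2"
      using binomial_mean_coeff_2_less[OF p N] \<theta> by (intro mult_strict_right_mono) auto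
    then show "\<exists>r\<in>{..N + Suc (Suc N)}. (\<Sum>a\<le>r. ?f (Suc N) a * ?f (Suc N) (r - a)) * ?u ^ r
      < (\<Sum>a\<le>r. ?f N a * ?f (Suc (Suc N)) (r - a)) * ?u ^ r"
      by (intro bexI[of _ 2]) auto
  qed simp
  ultimately show ?thesis
    unfolding power2_eq_square binomial_mean_moment_mult[OF \<theta>(2)]
    using \<theta> by (simp only: mult_strict_left_mono zero_less_power diff_gt_0_iff_gt)
qed

section \<open>Expectations of functions of a Bernoulli sum\<close>

text \<open>Pascal's rule, read as conditioning on one of \<open>Suc n\<close> trials: a success
  shifts the argument of \<open>g\<close>.\<close>

lemma sum_choose_Suc_split:
  fixes g :: "nat \<Rightarrow> real"
  shows "(\<Sum>k\<le>Suc n. real (Suc n choose k) * g k * s ^ k * t ^ (Suc n - k))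
    = s * (\<Sum>k\<le>n. real (n choose k) * g (Suc k) * s ^ k * t ^ (n - k))
      + t * (\<Sum>k\<le>n. real (n choose k) * g k * s ^ k * t ^ (n - k))"
proof -
  have "t * (\<Sum>k\<le>n. real (n choose k) * g k * s ^ k * t ^ (n - k))
      = (\<Sum>k\<le>n. real (n choose k) * g k * s ^ k * t ^ (Suc n - k))"
    unfolding sum_distrib_left by (intro sum.cong) (auto simp: Suc_diff_le)
  also have "\<dots> = (\<Sum>k\<le>Suc n. real (n choose k) * g k * s ^ k * t ^ (Suc n - k))"
    by simp
  finally show ?thesis
    unfolding sum.atMost_Suc_shift
    by (simp add: sum.distrib sum_distrib_left algebra_simps)
qed

text \<open>Induction on \<open>n\<close> with \<open>g\<close> arbitrary, because a success in the
  new trial replaces \<open>g\<close> by \<open>\<lambda>s. g (s + 1)\<close>. Integrability is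
  carried along to factor expectations of independent products.\<close>

lemma (in prob_space) expectation_bernoulli_sum:
  fixes X :: "nat \<Rightarrow> 'a \<Rightarrow> real" and g :: "real \<Rightarrow> real"
  assumes \<theta>: "0 \<le> \<theta>" "\<theta> \<le> 1"
    and indep: "indep_vars (\<lambda>_. borel) X {1..}"
    and law: "\<And>i. i \<ge> 1 \<Longrightarrow> distr M borel (X i) = bernoulli_law \<theta>"
    and g: "g \<in> borel_measurable borel"
  shows "integrable M (\<lambda>\<omega>. g (\<Sum>i=1..n. X i \<omega>)) \<and>
    expectation (\<lambda>\<omega>. g (\<Sum>i=1..n. X i \<omega>))
      = (\<Sum>k\<le>n. real (n choose k) * g (real k) * \<theta> ^ k * (1 - \<theta>) ^ (n - k))"
  using g
proof (induction n arbitrary: g)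
  case 0
  then show ?case
    by (simp add: prob_space)
next
  case (Suc n)
  note [measurable] = Suc.prems
  let ?S = "\<lambda>\<omega>. \<Sum>i=1..n. X i \<omega>" and ?Y = "X (Suc n)"
  have X_meas [measurable]: "X i \<in> borel_measurable M" if "1 \<le> i" for i
    using indep that unfolding indep_vars_def2 by auto
  have Y_meas [measurable]: "?Y \<in> borel_measurable M"
    by (rule X_meas) simp
  have S_meas [measurable]: "?S \<in> borel_measurable M"
    by (intro borel_measurable_sum X_meas) auto
  have law_Y: "distr M borel ?Y = bernoulli_law \<theta>"
    by (rule law) simp
  have "AE y in bernoulli_law \<theta>. y = 0 \<or> y = 1"
    unfolding bernoulli_law_def by (subst AE_distr_iff) auto
  then have Y01: "AE \<omega> in M. ?Y \<omega> = 0 \<or> ?Y \<omega> = 1"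
    unfolding law_Y[symmetric] by (subst (asm) AE_distr_iff) auto
  have "expectation ?Y = integral\<^sup>L (distr M borel ?Y) (\<lambda>y. y)"
    by (subst integral_distr) auto
  also have "\<dots> = \<theta>"
    unfolding law_Y bernoulli_law_def using \<theta> by (subst integral_distr) auto
  finally have EY: "expectation ?Y = \<theta>" .
  have int_Y: "integrable M ?Y"
    by (rule integrable_const_bound[where B = 1]) (use Y01 in auto)
  have "indep_var borel ?Y borel ?S"
    by (rule indep_vars_sum) (use indep in \<open>auto intro: indep_vars_subset\<close>)
  then have ind: "indep_var borel (\<lambda>\<omega>. g1 (?Y \<omega>)) borel (\<lambda>\<omega>. g2 (?S \<omega>))"
    if "g1 \<in> borel_measurable borel" "g2 \<in> borel_measurable borel" for g1 g2 :: "real \<Rightarrow> real"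
    using indep_var_compose[of borel ?Y borel ?S g1 borel g2 borel] that by (simp add: comp_def)
  have prod: "integrable M (\<lambda>\<omega>. g1 (?Y \<omega>) * g2 (?S \<omega>))"
      "expectation (\<lambda>\<omega>. g1 (?Y \<omega>) * g2 (?S \<omega>)) = expectation (\<lambda>\<omega>. g1 (?Y \<omega>)) * expectation (\<lambda>\<omega>. g2 (?S \<omega>))"
    if "g2 \<in> borel_measurable borel" "g1 \<in> borel_measurable borel" "integrable M (\<lambda>\<omega>. g1 (?Y \<omega>))"
    for g1 g2 :: "real \<Rightarrow> real"
    using indep_var_integrable[OF ind[OF that(2) that(1)]] indep_var_lebesgue_integral[OF ind[OF that(2) that(1)]]
      Suc.IH[OF that(1)] that(3) by auto
  \<comment> \<open>As \<open>?Y\<close> is almost surely 0 or 1, \<open>?h\<close> agrees almost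
    surely with \<open>g\<close> of the longer sum, and each of its terms is a product of
    independent factors.\<close>
  let ?h = "\<lambda>\<omega>. ?Y \<omega> * g (?S \<omega> + 1) + (1 - ?Y \<omega>) * g (?S \<omega>)"
  have shift [measurable]: "(\<lambda>s. g (s + 1)) \<in> borel_measurable borel"
    by measurable
  note h1 = prod[OF shift, of "\<lambda>y. y"] and h2 = prod[OF Suc.prems, of "\<lambda>y. 1 - y"]
  have h_int: "integrable M ?h"
    using h1(1) h2(1) int_Y by simp
  have "expectation ?h = \<theta> * expectation (\<lambda>\<omega>. g (?S \<omega> + 1)) + (1 - \<theta>) * expectation (\<lambda>\<omega>. g (?S \<omega>))"
    using h1 h2 int_Y EY by (simp add: prob_space)
  also have "\<dots> = (\<Sum>k\<le>Suc n. real (Suc n choose k) * g (real k) * \<theta> ^ k * (1 - \<theta>) ^ (Suc n - k))"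
    using Suc.IH[OF shift] Suc.IH[OF Suc.prems]
    unfolding sum_choose_Suc_split[of n "\<lambda>k. g (real k)"] by (simp add: add.commute)
  finally have h_exp: "expectation ?h = \<dots>" .
  have eq: "AE \<omega> in M. g (\<Sum>i=1..Suc n. X i \<omega>) = ?h \<omega>"
    using Y01 by eventually_elim auto
  have meas: "(\<lambda>\<omega>. g (\<Sum>i=1..Suc n. X i \<omega>)) \<in> borel_measurable M"
    by simp
  show ?case
    using integrable_cong_AE[OF meas _ eq] integral_cong_AE[OF meas _ eq] h_int h_exp by auto
qed

theorem theorem3p1:
  fixes M :: "'a measure" and X :: "nat \<Rightarrow> 'a \<Rightarrow> real" and p \<theta> :: real
  assumes "prob_space M"
    and "p \<ge> 1"
    and "0 \<le> \<theta>" and "\<theta> \<le> 1"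
    and "prob_space.indep_vars M (\<lambda>_. borel) X {1..}"
    and "\<And>i. i \<ge> 1 \<Longrightarrow> distr M borel (X i) = bernoulli_law \<theta>"
  shows "(\<forall>n\<ge>1. integrable M (\<lambda>\<omega>. sample_mean X n \<omega> powr p) \<and>
            mean_moment M X p n =
              (\<Sum>k=0..n. real (n choose k) * (real k / real n) powr p * \<theta> ^ k * (1 - \<theta>) ^ (n - k)))
       \<and> log_convex_seq (mean_moment M X p)
       \<and> (\<forall>n\<ge>2. (mean_moment M X p n)\<^sup>2 \<le> mean_moment M X p (n - 1) * mean_moment M X p (n + 1))
       \<and> (p > 1 \<longrightarrow> 0 < \<theta> \<longrightarrow> \<theta> < 1 \<longrightarrow>
            (\<forall>n\<ge>2. (mean_moment M X p n)\<^sup>2 < mean_moment M X p (n - 1) * mean_moment M X p (n + 1)))"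
proof -
  interpret prob_space M
    by fact
  have "(\<lambda>s :: real. (s / real n) powr p) \<in> borel_measurable borel" for n
    by measurable
  note E = expectation_bernoulli_sum[OF assms(3-6) this]
  have moment: "mean_moment M X p n = binomial_mean_moment p \<theta> n" for n
    using E unfolding mean_moment_def sample_mean_def binomial_mean_moment_def atLeast0AtMost by blast
  have int: "integrable M (\<lambda>\<omega>. sample_mean X n \<omega> powr p)" for n
    using E unfolding sample_mean_def by blast
  \<comment> \<open>The binomial estimates are centred at \<open>Suc N\<close> with
    \<open>1 \<le> N\<close>, which matches \<open>2 \<le> n\<close>.\<close>
  have pred: "\<exists>N\<ge>1. n = Suc N" if "2 \<le> n" for n :: nat
    using that by (intro exI[of _ "n - 1"]) auto
  have le: "(mean_moment M X p n)\<^sup>2 \<le> mean_moment M X p (n - 1) * mean_moment M X p (n + 1)"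
    if "2 \<le> n" for n
    using pred[OF that] binomial_mean_moment_log_convex[OF assms(2-4)] unfolding moment by auto
  have less: "(mean_moment M X p n)\<^sup>2 < mean_moment M X p (n - 1) * mean_moment M X p (n + 1)"
    if "1 < p" "0 < \<theta>" "\<theta> < 1" "2 \<le> n" for n
    using pred[OF that(4)] binomial_mean_moment_strict_log_convex[OF that(1-3)] unfolding moment by auto
  show ?thesis
    using int le less binomial_mean_moment_nonneg[OF assms(3,4)]
    by (auto simp: log_convex_seq_def moment binomial_mean_moment_def)
qed

end
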